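(* Let $\varepsilon>0$. For a dataset $D=[x]$ of $n$ records $x_i\in[0,1]$, put $r=\frac1n\sum_{i=1}^n x_i$ and $v=\frac1n\sum_{i=1}^n(x_i-r)^2$, and define $$C_b(r,v)=3v^2-2(3r^2-3r+1)v+3r^4-6r^3+7r^2-4r+1,$$ $$C_c(r,v)=(1-2r+2r^2)^2-2v(1-2r)^2+4v^2,\qquad C_u(r,v)=v^2+(1-v)^2.$$ Then the variance estimators $\hat v_b,\hat v_c,\hat v_u$ (defined in the context) satisfy $$R(\hat v_b,\mathrm{Var},D)\le\frac2{\varepsilon^2}(C_b(r,v)+o(1)),\quad R(\hat v_c,\mathrm{Var},D)\le\frac2{\varepsilon^2}(C_c(r,v)+o(1)),\quad R(\hat v_u,\mathrm{Var},D)\le\frac2{\varepsilon^2}(C_u(r,v)+o(1)),$$ where $o(1)\to0$ as $n=|D|\to\infty$ (with $\varepsilon$ fixed). Furthermore, for all possible $(r,v)$, i.e. all pairs that are the mean and variance of some dataset of records in $[0,1]$, $$C_b(r,v)\le C_c(r,v)\le C_u(r,v).$$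
   Context: $\mathrm{Lap}(b)$ is the Laplace distribution with density $\frac1{2b}e^{-|t|/b}$; all noise variables below are independent $\mathrm{Lap}(1/\varepsilon)$. $\mathrm{clip}(t,[l,u])=\max\{l,\min\{u,t\}\}$. (Events $\tilde n=0$ have probability $0$.) $\mathrm{Var}([x])=\frac1n\sum_{i}x_i^2-(\frac1n\sum_i x_i)^2$. For a randomized estimator $\hat f$, $R(\hat f,\mathrm{Var},D)=|D|^2\,\mathbb E[(\hat f(D)-\mathrm{Var}(D))^2]$, where $|D|=n$ is the number of records. Estimator $\hat v_b$: $\tilde b_0=\sum_i(1-x_i)^2+Z_0$, $\tilde b_1=\sum_i2x_i(1-x_i)+Z_1$, $\tilde b_2=\sum_i x_i^2+Z_2$; $\tilde n=\tilde b_0+\tilde b_1+\tilde b_2$, $\tilde s_x=\tilde b_1/2+\tilde b_2$, $\tilde s_{x^2}=\tilde b_2$; $\hat v_b=\mathrm{clip}\big(\tilde s_{x^2}/\tilde n-(\tilde s_x/\tilde n)^2,[0,1/4]\big)$. Estimator $\hat v_c$: $\hat v_c([x])=\hat c([x,x])$, where for a dataset $[x,y]$ of records $(x_i,y_i)\in[0,1]^2$: $\tilde b_{1,1}=\sum_ix_iy_i+Z_{1,1}$, $\tilde b_{1,0}=\sum_ix_i(1-y_i)+Z_{1,0}$, $\tilde b_{0,1}=\sum_i(1-x_i)y_i+Z_{0,1}$, $\tilde b_{0,0}=\sum_i(1-x_i)(1-y_i)+Z_{0,0}$; $\tilde n=\tilde b_{0,0}+\tilde b_{0,1}+\tilde b_{1,0}+\tilde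 b_{1,1}$, $\tilde s_x=\tilde b_{1,0}+\tilde b_{1,1}$, $\tilde s_y=\tilde b_{0,1}+\tilde b_{1,1}$, $\tilde s_{xy}=\tilde b_{1,1}$; $\hat c=\mathrm{clip}\big(\tilde s_{xy}/\tilde n-(\tilde s_x/\tilde n)(\tilde s_y/\tilde n),[-1/4,1/4]\big)$. Estimator $\hat v_u$: with $u=\sum_ix_i^2-\frac1n(\sum_ix_i)^2$, $\tilde b_0=n-u+Z_0$, $\tilde b_1=u+Z_1$, $\tilde n=\tilde b_0+\tilde b_1$; $\hat v_u=\mathrm{clip}(\tilde b_1/\tilde n,[0,1/4])$. *)

theory Defs
  imports "HOL-Probability.Probability"
begin

definition laplace_density :: "real \<Rightarrow> real \<Rightarrow> real" where
  "laplace_density b t = 1 / (2 * b) * exp (- \<bar>t\<bar> / b)"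

definition laplace :: "real \<Rightarrow> real measure" where
  "laplace b = density lborel (\<lambda>t. ennreal (laplace_density b t))"

text \<open>The law of a family, indexed by \<open>I\<close>, of independent Laplace variables of scale \<open>1 / \<epsilon>\<close>.\<close>

definition noise :: "real \<Rightarrow> 'i set \<Rightarrow> ('i \<Rightarrow> real) measure" where
  "noise \<epsilon> I = (\<Pi>\<^sub>M i\<in>I. laplace (1 / \<epsilon>))"

definition clip :: "real \<Rightarrow> real \<Rightarrow> real \<Rightarrow> real" where
  "clip t l u = max l (min u t)"

definition mean :: "real list \<Rightarrow> real" where
  "mean xs = sum_list xs / real (length xs)"

definition centered_var :: "real list \<Rightarrow> real" where
  "centered_var xs = (\<Sum>x\<leftarrow>xs. (x - mean xs)\<^sup>2) / real (length xs)"

definition data_var :: "real list \<Rightarrow> real" where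
  "data_var xs = (\<Sum>x\<leftarrow>xs. x\<^sup>2) / real (length xs) - (sum_list xs / real (length xs))\<^sup>2"

text \<open>A randomized estimator maps a dataset to the law of its output. All estimators below
  have bounded outputs, so the Bochner integral is a genuine expectation.\<close>

definition risk :: "('a list \<Rightarrow> real measure) \<Rightarrow> ('a list \<Rightarrow> real) \<Rightarrow> 'a list \<Rightarrow> real" where
  "risk F f D = (real (length D))\<^sup>2 * (LINT t|F D. (t - f D)\<^sup>2)"

text \<open>In the three outcome functions \<open>z\<close> is a realization of the noise. On the null event
  that the noisy count vanishes, the quotients take the value \<open>0\<close>.\<close>

definition vb_outcome :: "real list \<Rightarrow> (nat \<Rightarrow> real) \<Rightarrow> real" where
  "vb_outcome xs z =
    (let b0 = (\<Sum>x\<leftarrow>xs. (1 - x)\<^sup>2) + z 0;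
         b1 = (\<Sum>x\<leftarrow>xs. 2 * x * (1 - x)) + z 1;
         b2 = (\<Sum>x\<leftarrow>xs. x\<^sup>2) + z 2;
         n = b0 + b1 + b2;
         s = b1 / 2 + b2
     in clip (b2 / n - (s / n)\<^sup>2) 0 (1 / 4))"

definition vb_hat :: "real \<Rightarrow> real list \<Rightarrow> real measure" where
  "vb_hat \<epsilon> xs = distr (noise \<epsilon> {0, 1, 2}) borel (vb_outcome xs)"

definition c_outcome :: "(real \<times> real) list \<Rightarrow> (nat \<times> nat \<Rightarrow> real) \<Rightarrow> real" where
  "c_outcome D z =
    (let b11 = (\<Sum>(x, y)\<leftarrow>D. x * y) + z (1, 1);
         b10 = (\<Sum>(x, y)\<leftarrow>D. x * (1 - y)) + z (1, 0);
         b01 = (\<Sum>(x, y)\<leftarrow>D. (1 - x) * y) + z (0, 1);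
         b00 = (\<Sum>(x, y)\<leftarrow>D. (1 - x) * (1 - y)) + z (0, 0);
         n = b00 + b01 + b10 + b11;
         sx = b10 + b11;
         sy = b01 + b11
     in clip (b11 / n - (sx / n) * (sy / n)) (- 1 / 4) (1 / 4))"

definition c_hat :: "real \<Rightarrow> (real \<times> real) list \<Rightarrow> real measure" where
  "c_hat \<epsilon> D = distr (noise \<epsilon> ({0, 1} \<times> {0, 1})) borel (c_outcome D)"

definition vc_hat :: "real \<Rightarrow> real list \<Rightarrow> real measure" where
  "vc_hat \<epsilon> xs = c_hat \<epsilon> (zip xs xs)"

definition vu_outcome :: "real list \<Rightarrow> (nat \<Rightarrow> real) \<Rightarrow> real" where
  "vu_outcome xs z =
    (let u = (\<Sum>x\<leftarrow>xs. x\<^sup>2) - 1 / real (length xs) * (sum_list xs)\<^sup>2;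
         b0 = real (length xs) - u + z 0;
         b1 = u + z 1;
         n = b0 + b1
     in clip (b1 / n) 0 (1 / 4))"

definition vu_hat :: "real \<Rightarrow> real list \<Rightarrow> real measure" where
  "vu_hat \<epsilon> xs = distr (noise \<epsilon> {0, 1}) borel (vu_outcome xs)"

definition C_b :: "real \<Rightarrow> real \<Rightarrow> real" where
  "C_b r v = 3 * v\<^sup>2 - 2 * (3 * r\<^sup>2 - 3 * r + 1) * v + 3 * r ^ 4 - 6 * r ^ 3 + 7 * r\<^sup>2 - 4 * r + 1"

definition C_c :: "real \<Rightarrow> real \<Rightarrow> real" where
  "C_c r v = (1 - 2 * r + 2 * r\<^sup>2)\<^sup>2 - 2 * v * (1 - 2 * r)\<^sup>2 + 4 * v\<^sup>2"

definition C_u :: "real \<Rightarrow> real \<Rightarrow> real" where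
  "C_u r v = v\<^sup>2 + (1 - v)\<^sup>2"

end

theory Submission
  imports Defs
begin

text \<open>
  Let \<open>M\<close> be the sum of the absolute values of the noise variables. Up to clipping, each estimator
  is a smooth function of noisy sums of order \<open>n\<close>, so \<open>n\<close> times its error is a fixed linear form
  \<open>L\<close> in the noise plus \<open>O(M\<^sup>2 / n)\<close>, uniformly in the data, as long as \<open>M \<le> n / 2\<close>. Otherwise the
  clipped error is at most \<open>1 \<le> 4 M\<^sup>2 / n\<^sup>2\<close>, so the same bound holds everywhere and no tail
  estimate is needed. Squaring and integrating leaves \<open>E L\<^sup>2 + O(1 / n)\<close>, and
  \<open>E L\<^sup>2 = 2 / \<epsilon>\<^sup>2\<close> times the sum of the squared coefficients of \<open>L\<close>. With
  \<open>w = r\<^sup>2 - v\<close> the coefficients are \<open>w, w - r, w + 1 - 2 r\<close> for the first estimator, the same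
  with \<open>w - r\<close> repeated for the second, and \<open>- v, 1 - v\<close> for the third.
\<close>

section \<open>Moments of Laplace variables and of the noise vector\<close>

text \<open>On the half-line the integral of \<open>exp (- x) * x ^ k\<close> is
  \<open>fact k\<close>. Reflection doubles it for even \<open>k\<close> and cancels it for odd
  \<open>k\<close>, and the substitution \<open>t = b * x\<close> brings in the scale.\<close>

lemma has_bochner_integral_laplace_power:
  assumes "b > 0"
  shows "has_bochner_integral (laplace b) (\<lambda>t. t ^ k) (if even k then fact k * b ^ k else 0)"
proof -
  define I where "I = (if even k then 2 * fact k else 0 :: real)"
  have half: "has_bochner_integral lborel (\<lambda>x::real. indicator {0..} x *\<^sub>R (exp (- \<bar>x\<bar>) * x ^ k)) (fact k)"
    by (rule has_bochner_integral_cong[THEN iffD1, OF _ _ _ has_bochner_integral_I0i_power_exp_m'[of k]])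
      (auto split: split_indicator)
  have "has_bochner_integral lborel (\<lambda>x::real. exp (- \<bar>x\<bar>) * x ^ k) I"
  proof (cases "even k")
    case True
    then show ?thesis
      using has_bochner_integral_even_function[OF half] by (simp add: I_def)
  next
    case False
    then show ?thesis
      using has_bochner_integral_odd_function[OF half] by (simp add: I_def)
  qed
  \<comment> \<open>The factor collects \<open>b ^ k\<close> from \<open>(b * x) ^ k\<close> and
    \<open>1 / (2 * b)\<close> from the density at \<open>b * x\<close>; the change of variables
    then contributes a further \<open>b\<close>.\<close>
  from has_bochner_integral_mult_right[OF this, of "b ^ k / (2 * b)"]
  have "has_bochner_integral lborel
      (\<lambda>x. laplace_density b (0 + b * x) *\<^sub>R (0 + b * x) ^ k) (b ^ k / (2 * b) * I)"
    using assms by (simp add: laplace_density_def abs_mult power_mult_distrib field_simps)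
  then have "has_bochner_integral lborel (\<lambda>t. laplace_density b t *\<^sub>R t ^ k) (b ^ k / 2 * I)"
    using assms by (subst lborel_has_bochner_integral_real_affine_iff[where c = b and t = 0])
      (simp_all add: field_simps)
  then have "has_bochner_integral (laplace b) (\<lambda>t. t ^ k) (b ^ k / 2 * I)"
    unfolding laplace_def using assms
    by (intro has_bochner_integral_density) (auto simp: laplace_density_def)
  then show ?thesis
    by (simp add: I_def mult.commute split: if_splits)
qed

lemma sets_laplace [measurable_cong]: "sets (laplace b) = sets borel"
  by (simp add: laplace_def)

text \<open>The zeroth moment is the total mass.\<close>

lemma prob_space_laplace:
  assumes "b > 0"
  shows "prob_space (laplace b)"
proof -
  have "has_bochner_integral (laplace b) (\<lambda>t. 1 :: real) 1"
    using has_bochner_integral_laplace_power[OF assms, of 0] by simp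
  then have int: "integrable (laplace b) (\<lambda>t. 1 :: real)" and "(LINT t|laplace b. 1) = (1 :: real)"
    by (auto simp: has_bochner_integral_iff)
  then have "measure (laplace b) (space (laplace b)) = 1"
    by simp
  moreover have "finite_measure (laplace b)"
    using int by (intro finite_measureI) (simp add: integrable_iff_bounded less_top)
  ultimately show ?thesis
    by (intro prob_spaceI) (simp add: finite_measure.emeasure_eq_measure)
qed

lemma prob_space_noise:
  assumes "\<epsilon> > 0"
  shows "prob_space (noise \<epsilon> I)"
  unfolding noise_def using assms by (intro prob_space_PiM prob_space_laplace) simp

lemma noise_component_measurable:
  assumes "i \<in> I"
  shows "(\<lambda>z. z i) \<in> borel_measurable (noise \<epsilon> I)"
  using measurable_component_singleton[OF assms, of "\<lambda>_. laplace (1 / \<epsilon>)"]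
  by (simp add: noise_def measurable_cong_sets[OF refl sets_laplace])

lemma has_bochner_integral_noise_product:
  assumes "\<epsilon> > 0" "finite I" "\<And>i. i \<in> I \<Longrightarrow> integrable (laplace (1 / \<epsilon>)) (f i)"
  shows "has_bochner_integral (noise \<epsilon> I) (\<lambda>z. \<Prod>i\<in>I. f i (z i))
    (\<Prod>i\<in>I. LINT t|laplace (1 / \<epsilon>). f i t :: real)"
proof -
  interpret prob_space "laplace (1 / \<epsilon>)"
    using assms by (intro prob_space_laplace) simp
  interpret product_sigma_finite "\<lambda>_ :: 'a. laplace (1 / \<epsilon>)"
    by standard
  show ?thesis
    using product_integrable_prod[OF assms(2,3)] product_integral_prod[OF assms(2,3)]
    by (simp add: has_bochner_integral_iff noise_def)
qed

text \<open>By independence a monomial in the noise integrates to a product of one-dimensional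
  moments. Off the diagonal a first moment occurs, which is zero by symmetry.\<close>

lemma noise_second_moment:
  assumes "\<epsilon> > 0" "finite I" "i \<in> I" "j \<in> I"
  shows "has_bochner_integral (noise \<epsilon> I) (\<lambda>z. z i * z j) (if i = j then 2 / \<epsilon>\<^sup>2 else 0)"
proof -
  \<comment> \<open>The exponent counts how often \<open>k\<close> occurs among \<open>i\<close> and
    \<open>j\<close>, so that both cases become one product over all of \<open>I\<close>.\<close>
  define e where "e k = (if k = i then 1 else 0) + (if k = j then 1 else 0 :: nat)" for k
  have mom: "has_bochner_integral (laplace (1 / \<epsilon>)) (\<lambda>t. t ^ e k)
      (if even (e k) then fact (e k) * (1 / \<epsilon>) ^ e k else 0)" for k
    using assms by (intro has_bochner_integral_laplace_power) simp
  have "has_bochner_integral (noise \<epsilon> I) (\<lambda>z. \<Prod>k\<in>I. z k ^ e k)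
      (\<Prod>k\<in>I. if even (e k) then fact (e k) * (1 / \<epsilon>) ^ e k else 0)"
    using has_bochner_integral_noise_product[OF assms(1,2), of "\<lambda>k t. t ^ e k"] mom
    by (simp add: has_bochner_integral_iff)
  also have "(\<lambda>z. \<Prod>k\<in>I. z k ^ e k) = (\<lambda>z :: 'a \<Rightarrow> real. z i * z j)"
  proof
    fix z :: "'a \<Rightarrow> real"
    have "z k ^ e k = (if k = i then z k else 1) * (if k = j then z k else 1)" for k
      by (simp add: e_def)
    then show "(\<Prod>k\<in>I. z k ^ e k) = z i * z j"
      using assms by (simp add: prod.distrib)
  qed
  also have "(\<Prod>k\<in>I. if even (e k) then fact (e k) * (1 / \<epsilon>) ^ e k else 0)
      = (if i = j then 2 / \<epsilon>\<^sup>2 else 0)"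
  proof (cases "i = j")
    case True
    then have "(if even (e k) then fact (e k) * (1 / \<epsilon>) ^ e k else 0)
        = (if k = i then 2 / \<epsilon>\<^sup>2 else 1)" for k
      by (simp add: e_def power2_eq_square)
    then show ?thesis
      using assms True by simp
  next
    case False
    then show ?thesis
      using assms by (auto simp: e_def intro!: prod_zero bexI[of _ i])
  qed
  finally show ?thesis .
qed

lemma noise_linear_second_moment:
  assumes "\<epsilon> > 0" "finite I"
  shows "has_bochner_integral (noise \<epsilon> I) (\<lambda>z. (\<Sum>i\<in>I. c i * z i)\<^sup>2) (2 / \<epsilon>\<^sup>2 * (\<Sum>i\<in>I. (c i)\<^sup>2))"
proof -
  have "has_bochner_integral (noise \<epsilon> I) (\<lambda>z. \<Sum>i\<in>I. \<Sum>j\<in>I. (c i * c j) * (z i * z j))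
      (\<Sum>i\<in>I. \<Sum>j\<in>I. (c i * c j) * (if i = j then 2 / \<epsilon>\<^sup>2 else 0))"
    by (intro has_bochner_integral_sum has_bochner_integral_mult_right noise_second_moment assms)
  moreover have "(\<Sum>i\<in>I. \<Sum>j\<in>I. (c i * c j) * (if i = j then 2 / \<epsilon>\<^sup>2 else 0))
      = 2 / \<epsilon>\<^sup>2 * (\<Sum>i\<in>I. (c i)\<^sup>2)"
    using assms by (simp add: if_distrib sum_distrib_left power2_eq_square mult_ac cong: if_cong)
  ultimately show ?thesis
    by (simp add: power2_eq_square sum_product mult_ac)
qed

text \<open>The squared pointwise error carries a term of order \<open>M ^ 4\<close>, whose
  expectation must be finite. It is dominated by single fourth powers through
  Cauchy-Schwarz.\<close>

lemma integrable_noise_fourth_power: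
  assumes "\<epsilon> > 0" "finite I"
  shows "integrable (noise \<epsilon> I) (\<lambda>z. (\<Sum>i\<in>I. \<bar>z i\<bar>) ^ 4)"
proof (rule Bochner_Integration.integrable_bound)
  have "integrable (noise \<epsilon> I) (\<lambda>z. z i ^ 4)" if "i \<in> I" for i
  proof -
    define e where "e k = (if k = i then 4 else 0 :: nat)" for k
    have "integrable (noise \<epsilon> I) (\<lambda>z. \<Prod>k\<in>I. z k ^ e k)"
      using has_bochner_integral_noise_product[OF assms, of "\<lambda>k t. t ^ e k"]
        has_bochner_integral_laplace_power[of "1 / \<epsilon>"] assms(1)
      by (auto simp: has_bochner_integral_iff)
    moreover have "(\<Prod>k\<in>I. z k ^ e k) = z i ^ 4" for z :: "'a \<Rightarrow> real"
      using that assms(2) by (simp add: e_def if_distrib cong: if_cong)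
    ultimately show ?thesis
      by simp
  qed
  then show "integrable (noise \<epsilon> I) (\<lambda>z. real (card I) ^ 3 * (\<Sum>i\<in>I. z i ^ 4))"
    by simp
  show "(\<lambda>z. (\<Sum>i\<in>I. \<bar>z i\<bar>) ^ 4) \<in> borel_measurable (noise \<epsilon> I)"
    by (intro borel_measurable_power borel_measurable_sum borel_measurable_abs noise_component_measurable)
  have "(\<Sum>i\<in>I. \<bar>z i\<bar>) ^ 4 \<le> real (card I) ^ 3 * (\<Sum>i\<in>I. z i ^ 4)" for z :: "'a \<Rightarrow> real"
  proof -
    \<comment> \<open>Cauchy-Schwarz is applied twice, first to \<open>\<bar>z i\<bar>\<close> and
      then to the squares. The squared first factor \<open>card I\<close> and the second one make up
      the cube.\<close>
    have "(\<Sum>i\<in>I. \<bar>z i\<bar>)\<^sup>2 \<le> (\<Sum>i\<in>I. (z i)\<^sup>2) * card I"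
      using sum_squared_le_sum_of_squares[of "\<lambda>i. \<bar>z i\<bar>" I] by simp
    then have "((\<Sum>i\<in>I. \<bar>z i\<bar>)\<^sup>2)\<^sup>2 \<le> ((\<Sum>i\<in>I. (z i)\<^sup>2) * card I)\<^sup>2"
      by (intro power_mono) auto
    also have "\<dots> \<le> ((\<Sum>i\<in>I. ((z i)\<^sup>2)\<^sup>2) * card I) * (real (card I))\<^sup>2"
      unfolding power_mult_distrib
      by (intro mult_right_mono sum_squared_le_sum_of_squares) simp
    finally show ?thesis
      by (simp add: eval_nat_numeral mult_ac)
  qed
  moreover have "norm ((\<Sum>i\<in>I. \<bar>z i\<bar>) ^ 4) = (\<Sum>i\<in>I. \<bar>z i\<bar>) ^ 4" for z :: "'a \<Rightarrow> real"
    unfolding real_norm_def by (intro abs_of_nonneg zero_le_even_power) simp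
  ultimately show "AE z in noise \<epsilon> I. norm ((\<Sum>i\<in>I. \<bar>z i\<bar>) ^ 4)
      \<le> norm (real (card I) ^ 3 * (\<Sum>i\<in>I. z i ^ 4))"
    unfolding real_norm_def by (metis (lifting) AE_I2 abs_ge_self order_trans)
qed

section \<open>Deterministic error bound for a clipped noisy ratio\<close>

text \<open>Clipping projects onto an interval containing the target. The first bound serves small
  noise, the second one noise so large that \<open>t\<close> carries no information.\<close>

lemma abs_clip_diff_le:
  assumes "l \<le> v" "v \<le> u"
  shows "\<bar>clip t l u - v\<bar> \<le> \<bar>t - v\<bar>" "\<bar>clip t l u - v\<bar> \<le> u - l"
  using assms by (auto simp: clip_def max_def min_def)

text \<open>The third estimator is covered by \<open>r = S = T = 0\<close>.\<close>

lemma clipped_ratio_error: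
  fixes n a r A S T N M l u :: real
  defines "L \<equiv> (A - a * N) - r * (S - r * N) - r * (T - r * N)"
  assumes n: "n \<ge> 1" and a: "0 \<le> a" "a \<le> 1" and r: "0 \<le> r" "r \<le> 1"
    and M: "\<bar>A\<bar> \<le> M" "\<bar>S\<bar> \<le> M" "\<bar>T\<bar> \<le> M" "\<bar>N\<bar> \<le> M"
    and lu: "l \<le> a - r\<^sup>2" "a - r\<^sup>2 \<le> u" "u - l \<le> 1"
  shows "(n * (clip ((n * a + A) / (n + N) - (n * r + S) / (n + N) * ((n * r + T) / (n + N))) l u
      - (a - r\<^sup>2)))\<^sup>2 \<le> L\<^sup>2 + (336 + 1120 * M ^ 4) / n"
    (is "(n * ?d)\<^sup>2 \<le> _")
proof -
  have small: "\<bar>X - c * N\<bar> \<le> 2 * M" if "0 \<le> c" "c \<le> 1" "\<bar>X\<bar> \<le> M" for X c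
  proof -
    have "\<bar>c * N\<bar> \<le> 1 * M"
      unfolding abs_mult using that M by (intro mult_mono) auto
    with that show ?thesis by linarith
  qed
  have scaled: "\<bar>r * X\<bar> \<le> 2 * M" if "\<bar>X\<bar> \<le> 2 * M" for X
    using mult_mono[of "\<bar>r\<bar>" 1 "\<bar>X\<bar>" "2 * M"] that r by (simp add: abs_mult)
  have L: "\<bar>L\<bar> \<le> 6 * M"
    using small[OF a M(1)] scaled[OF small[OF r M(2)]] scaled[OF small[OF r M(3)]]
    unfolding L_def by linarith
  have M0: "0 \<le> M" using M by linarith
  have "n * \<bar>?d\<bar> \<le> \<bar>L\<bar> + 28 * M\<^sup>2 / n"
  proof (cases "M \<le> n / 2")
    case True
    define D where "D = n + N"
    \<comment> \<open>Since \<open>\<bar>N\<bar> \<le> M \<le> n / 2\<close>, the noisy count keeps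
      at least half of its true value.\<close>
    have D: "n / 2 \<le> D" "0 < D"
      using True M n by (auto simp: D_def)
    \<comment> \<open>These are the deviations of the three noisy ratios from \<open>a\<close>,
      \<open>r\<close> and \<open>r\<close>. Expanding \<open>(r + \<sigma>) * (r + \<tau>)\<close>
      leaves the linear part \<open>L / D\<close> and the quadratic part
      \<open>\<sigma> * \<tau>\<close>.\<close>
    define \<alpha> where "\<alpha> = (A - a * N) / D"
    define \<sigma> where "\<sigma> = (S - r * N) / D"
    define \<tau> where "\<tau> = (T - r * N) / D"
    have quot: "(n * c + X) / D = c + (X - c * N) / D" for c X
      using D by (simp add: field_simps D_def)
    have L': "L / D = \<alpha> - r * \<sigma> - r * \<tau>"
      by (simp add: L_def \<alpha>_def \<sigma>_def \<tau>_def diff_divide_distrib add_divide_distrib algebra_simps)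
    have "n * ((n * a + A) / D - (n * r + S) / D * ((n * r + T) / D) - (a - r\<^sup>2))
        = n * (L / D - \<sigma> * \<tau>)"
      unfolding L' quot by (simp add: \<alpha>_def \<sigma>_def \<tau>_def power2_eq_square algebra_simps)
    \<comment> \<open>Here \<open>n / D = 1 - N / D\<close> isolates the form \<open>L\<close> with
      deterministic coefficients.\<close>
    also have "\<dots> = L - N * L / D - n * (\<sigma> * \<tau>)"
      using D by (simp add: field_simps D_def)
    finally have eq: "n * ((n * a + A) / D - (n * r + S) / D * ((n * r + T) / D) - (a - r\<^sup>2))
      = L - N * L / D - n * (\<sigma> * \<tau>)" .
    \<comment> \<open>Dividing by \<open>D\<close> costs at most a factor \<open>2 / n\<close>. So
      \<open>\<bar>N * L\<bar> \<le> 6 * M\<^sup>2\<close> yields the constant 12, and the bound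
      \<open>4 * M / n\<close> on both \<open>\<bar>\<sigma>\<bar>\<close> and
      \<open>\<bar>\<tau>\<bar>\<close> yields 16; together they give 28.\<close>
    have by_D: "\<bar>X / D\<bar> \<le> Y / (n / 2)" if "\<bar>X\<bar> \<le> Y" for X Y
      unfolding abs_divide using that D n by (intro frac_le) auto
    have "\<bar>N * L\<bar> \<le> M * (6 * M)"
      unfolding abs_mult using M L by (intro mult_mono) auto
    then have e1: "\<bar>N * L / D\<bar> \<le> 12 * M\<^sup>2 / n"
      using by_D[of "N * L" "M * (6 * M)"] by (simp add: power2_eq_square mult_ac)
    have "\<bar>\<sigma> * \<tau>\<bar> \<le> (4 * M / n) * (4 * M / n)"
      unfolding abs_mult \<sigma>_def \<tau>_def
      using by_D[OF small[OF r M(2)]] by_D[OF small[OF r M(3)]] M0 n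
      by (intro mult_mono) auto
    then have "n * \<bar>\<sigma> * \<tau>\<bar> \<le> n * ((4 * M / n) * (4 * M / n))"
      using n by (intro mult_left_mono) auto
    then have e2: "\<bar>n * (\<sigma> * \<tau>)\<bar> \<le> 16 * M\<^sup>2 / n"
      using n by (simp add: abs_mult power2_eq_square)
    have "n * \<bar>?d\<bar> \<le> \<bar>L - N * L / D - n * (\<sigma> * \<tau>)\<bar>"
      unfolding eq[symmetric] abs_mult using n abs_clip_diff_le(1)[OF lu(1,2)]
      by (auto simp: D_def intro: mult_left_mono)
    also have "\<dots> \<le> \<bar>L\<bar> + \<bar>N * L / D\<bar> + \<bar>n * (\<sigma> * \<tau>)\<bar>"
      by (rule order_trans[OF abs_triangle_ineq4 add_right_mono[OF abs_triangle_ineq4]])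
    also have "\<dots> \<le> \<bar>L\<bar> + 12 * M\<^sup>2 / n + 16 * M\<^sup>2 / n"
      using e1 e2 by (intro add_mono) auto
    finally show ?thesis by simp
  next
    case False
    \<comment> \<open>Now \<open>n < 2 * M\<close>, so the trivial bound by the interval length is
      already of order \<open>M\<^sup>2 / n\<close>. A vanishing count \<open>n + N\<close>, where
      the quotients are 0 by convention, falls under this case.\<close>
    have "n * \<bar>?d\<bar> \<le> n * 1"
      using abs_clip_diff_le(2)[OF lu(1,2)] lu(3) n by (intro mult_left_mono) (auto intro: order_trans)
    also have "\<dots> \<le> 4 * M\<^sup>2 / n"
    proof -
      have "n * n \<le> (2 * M) * (2 * M)"
        using False n by (intro mult_mono) auto
      then show ?thesis using n by (simp add: field_simps power2_eq_square)
    qed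
    also have "\<dots> \<le> \<bar>L\<bar> + 28 * M\<^sup>2 / n"
      using n by (simp add: divide_right_mono add_increasing)
    finally show ?thesis .
  qed
  then have "(n * \<bar>?d\<bar>)\<^sup>2 \<le> (\<bar>L\<bar> + 28 * M\<^sup>2 / n)\<^sup>2"
    using n by (intro power_mono) auto
  also have "\<dots> = L\<^sup>2 + (56 * (\<bar>L\<bar> * M\<^sup>2) + 784 * M ^ 4 / n) / n"
    using n by (simp add: power2_eq_square field_simps eval_nat_numeral)
  \<comment> \<open>With \<open>\<bar>L\<bar> \<le> 6 * M\<close> and
    \<open>M ^ 3 \<le> 1 + M ^ 4\<close>, the cross term contributes \<open>56 * 6 = 336\<close> to
    both coefficients, and \<open>336 + 784 = 1120\<close>.\<close>
  also have "\<dots> \<le> L\<^sup>2 + (336 + 1120 * M ^ 4) / n"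
  proof -
    have "\<bar>L\<bar> * M\<^sup>2 \<le> 6 * M * M\<^sup>2"
      using L by (intro mult_right_mono) auto
    moreover have "M * M\<^sup>2 \<le> 1 + M ^ 4"
    proof (cases "M \<le> 1")
      case True
      then have "M ^ 3 \<le> 1" using M0 by (simp add: power_le_one)
      then show ?thesis by (simp add: power2_eq_square power3_eq_cube add_increasing2 mult.assoc)
    next
      case False
      then have "M ^ 3 \<le> M ^ 4" by (intro power_increasing) auto
      then show ?thesis by (simp add: power2_eq_square power3_eq_cube mult.assoc)
    qed
    moreover have "784 * M ^ 4 / n \<le> 784 * M ^ 4 / 1"
      using n by (intro divide_left_mono) auto
    ultimately have "56 * (\<bar>L\<bar> * M\<^sup>2) + 784 * M ^ 4 / n \<le> 336 + 1120 * M ^ 4"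
      by simp
    then show ?thesis using n by (simp add: divide_right_mono)
  qed
  finally show ?thesis by (simp add: power_mult_distrib)
qed

section \<open>From the pointwise bound to the risk\<close>

text \<open>This is the explicit \<open>o(1)\<close> term. The factor
  \<open>\<epsilon>\<^sup>2 / 2\<close> cancels the prefactor of the risk bounds, and the data enter
  only through their number.\<close>

definition remainder :: "real \<Rightarrow> 'i set \<Rightarrow> nat \<Rightarrow> real" where
  "remainder \<epsilon> I n = \<epsilon>\<^sup>2 / 2 * (LINT z|noise \<epsilon> I. 336 + 1120 * (\<Sum>i\<in>I. \<bar>z i\<bar>) ^ 4) / real n"

lemma remainder_tendsto_0: "remainder \<epsilon> I \<longlonglongrightarrow> 0"
  unfolding remainder_def by (rule lim_const_over_n)

lemma scaled_mse_le:
  assumes "\<epsilon> > 0" "finite I" "h \<in> borel_measurable (noise \<epsilon> I)" "m \<ge> 1"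
    and bound: "\<And>z. (real m * (h z - v))\<^sup>2
      \<le> (\<Sum>i\<in>I. c i * z i)\<^sup>2 + (336 + 1120 * (\<Sum>i\<in>I. \<bar>z i\<bar>) ^ 4) / real m"
  shows "(real m)\<^sup>2 * (LINT t|distr (noise \<epsilon> I) borel h. (t - v)\<^sup>2)
    \<le> 2 / \<epsilon>\<^sup>2 * ((\<Sum>i\<in>I. (c i)\<^sup>2) + remainder \<epsilon> I m)"
proof -
  interpret prob_space "noise \<epsilon> I"
    by (rule prob_space_noise) fact
  have int: "integrable (noise \<epsilon> I) (\<lambda>z. 336 + 1120 * (\<Sum>i\<in>I. \<bar>z i\<bar>) ^ 4)"
    using integrable_noise_fourth_power[OF assms(1,2)] by simp
  have lin: "integrable (noise \<epsilon> I) (\<lambda>z. (\<Sum>i\<in>I. c i * z i)\<^sup>2)"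
      "(LINT z|noise \<epsilon> I. (\<Sum>i\<in>I. c i * z i)\<^sup>2) = 2 / \<epsilon>\<^sup>2 * (\<Sum>i\<in>I. (c i)\<^sup>2)"
    using noise_linear_second_moment[OF assms(1,2), of c] by (auto simp: has_bochner_integral_iff)
  have "(real m)\<^sup>2 * (LINT t|distr (noise \<epsilon> I) borel h. (t - v)\<^sup>2)
      = (LINT z|noise \<epsilon> I. (real m * (h z - v))\<^sup>2)"
    using assms(3) by (subst integral_distr) (auto simp: power_mult_distrib)
  also have "\<dots> \<le> (LINT z|noise \<epsilon> I. (\<Sum>i\<in>I. c i * z i)\<^sup>2
      + (336 + 1120 * (\<Sum>i\<in>I. \<bar>z i\<bar>) ^ 4) / real m)"
    using lin int bound by (intro integral_mono') auto
  also have "\<dots> = 2 / \<epsilon>\<^sup>2 * (\<Sum>i\<in>I. (c i)\<^sup>2)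
      + (LINT z|noise \<epsilon> I. 336 + 1120 * (\<Sum>i\<in>I. \<bar>z i\<bar>) ^ 4) / real m"
    using lin int by (subst Bochner_Integration.integral_add) (auto simp del: Bochner_Integration.integral_add)
  also have "\<dots> = 2 / \<epsilon>\<^sup>2 * ((\<Sum>i\<in>I. (c i)\<^sup>2) + remainder \<epsilon> I m)"
    using assms(1) by (simp add: remainder_def distrib_left del: Bochner_Integration.integral_add)
  finally show ?thesis .
qed


section \<open>Moments of datasets in the unit interval\<close>

lemma sum_list_square_diff:
  fixes m :: real
  shows "(\<Sum>x\<leftarrow>xs. (x - m)\<^sup>2) = (\<Sum>x\<leftarrow>xs. x\<^sup>2) - 2 * m * sum_list xs + real (length xs) * m\<^sup>2"
  by (induction xs) (simp_all add: power2_eq_square algebra_simps)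

lemma centered_var_eq_data_var: "centered_var xs = data_var xs"
proof (cases "xs = []")
  case False
  then show ?thesis
    unfolding centered_var_def data_var_def sum_list_square_diff mean_def
    by (simp add: power2_eq_square field_simps)
qed (simp add: centered_var_def data_var_def)

definition mean_sq :: "real list \<Rightarrow> real" where
  "mean_sq xs = (\<Sum>x\<leftarrow>xs. x\<^sup>2) / real (length xs)"

lemma sums_eq_means:
  assumes "xs \<noteq> []"
  shows "sum_list xs = real (length xs) * mean xs"
    and "(\<Sum>x\<leftarrow>xs. x\<^sup>2) = real (length xs) * mean_sq xs"
  using assms by (simp_all add: mean_def mean_sq_def)

lemma data_var_eq: "data_var xs = mean_sq xs - (mean xs)\<^sup>2"
  by (simp add: data_var_def mean_sq_def mean_def)

text \<open>Everything rests on \<open>x\<^sup>2 \<le> x\<close> for \<open>x\<close> in the unit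
  interval, which gives \<open>v \<le> r - r\<^sup>2 \<le> 1 / 4\<close>. The last bound places the
  target inside every clipping interval.\<close>

lemma unit_interval_moments:
  assumes "xs \<noteq> []" "set xs \<subseteq> {0..1}"
  shows "0 \<le> mean xs" "mean xs \<le> 1" "0 \<le> mean_sq xs" "mean_sq xs \<le> mean xs" "0 \<le> data_var xs"
    "data_var xs \<le> mean xs * (1 - mean xs)" "data_var xs \<le> 1 / 4"
proof -
  have n: "real (length xs) > 0"
    using assms(1) by simp
  have "0 \<le> sum_list xs \<and> sum_list xs \<le> real (length xs) \<and> (\<Sum>x\<leftarrow>xs. x\<^sup>2) \<le> sum_list xs"
    using assms(2)
  proof (induction xs)
    case (Cons x xs)
    then show ?case
      using power_decreasing[of 1 2 x] by auto
  qed simp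
  with n show bounds: "0 \<le> mean xs" "mean xs \<le> 1" "mean_sq xs \<le> mean xs"
    by (auto simp: mean_def mean_sq_def divide_right_mono)
  show "0 \<le> mean_sq xs"
    unfolding mean_sq_def by (intro divide_nonneg_nonneg sum_list_nonneg) auto
  show "0 \<le> data_var xs"
    unfolding centered_var_eq_data_var[symmetric] centered_var_def
    by (intro divide_nonneg_nonneg sum_list_nonneg) auto
  show le: "data_var xs \<le> mean xs * (1 - mean xs)"
    using bounds by (simp add: data_var_eq power2_eq_square algebra_simps)
  have "0 \<le> (mean xs - 1 / 2)\<^sup>2"
    by simp
  with le show "data_var xs \<le> 1 / 4"
    by (simp add: power2_eq_square algebra_simps)
qed

section \<open>Risk bounds for the three estimators\<close>

text \<open>The three bin weights of a record add up to 1, so the noisy count is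
  \<open>n + N\<close> with \<open>N\<close> the total noise. The general error bound then applies
  with \<open>A = z 2\<close> and \<open>S = T = z 1 / 2 + z 2\<close>.\<close>

lemma risk_vb_le:
  assumes "\<epsilon> > 0" and xs: "xs \<noteq> []" "set xs \<subseteq> {0..1}"
  shows "risk (vb_hat \<epsilon>) data_var xs
    \<le> 2 / \<epsilon>\<^sup>2 * (C_b (mean xs) (centered_var xs) + remainder \<epsilon> {0, 1, 2 :: nat} (length xs))"
proof -
  define n where "n = real (length xs)"
  define r where "r = mean xs"
  define a where "a = mean_sq xs"
  \<comment> \<open>Since \<open>w = 2 * r\<^sup>2 - a\<close>, this is the coefficient of
    \<open>N\<close> in the linear form. Every noise variable inherits it, and \<open>c\<close> adds
    the direct contribution of each bin.\<close>
  define w where "w = r\<^sup>2 - data_var xs"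
  define c :: "nat \<Rightarrow> real"
    where "c i = (if i = 0 then w else if i = 1 then w - r else w + 1 - 2 * r)" for i
  have sums: "sum_list xs = n * r" "(\<Sum>x\<leftarrow>xs. x\<^sup>2) = n * a"
    using sums_eq_means[OF xs(1)] by (simp_all add: n_def r_def a_def)
  have "(\<Sum>x\<leftarrow>xs. (1 - x)\<^sup>2) = n - 2 * sum_list xs + (\<Sum>x\<leftarrow>xs. x\<^sup>2)"
    unfolding n_def by (induction xs) (simp_all add: power2_eq_square algebra_simps)
  then have s0: "(\<Sum>x\<leftarrow>xs. (1 - x)\<^sup>2) = n - 2 * (n * r) + n * a"
    unfolding sums .
  have "(\<Sum>x\<leftarrow>xs. 2 * x * (1 - x)) = 2 * sum_list xs - 2 * (\<Sum>x\<leftarrow>xs. x\<^sup>2)"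
    by (induction xs) (simp_all add: power2_eq_square algebra_simps)
  then have s1: "(\<Sum>x\<leftarrow>xs. 2 * x * (1 - x)) = 2 * (n * r) - 2 * (n * a)"
    unfolding sums .
  have v: "data_var xs = a - r\<^sup>2"
    by (simp add: a_def r_def data_var_eq)
  have bounds: "1 \<le> n" "0 \<le> a" "a \<le> 1" "0 \<le> r" "r \<le> 1" "0 \<le> a - r\<^sup>2" "a - r\<^sup>2 \<le> 1 / 4"
    using unit_interval_moments[OF xs] xs(1)
    unfolding data_var_eq a_def r_def n_def by (auto simp: Suc_le_eq)
  have meas: "vb_outcome xs \<in> borel_measurable (noise \<epsilon> {0, 1, 2})"
  proof -
    have [measurable]: "(\<lambda>z. z 0) \<in> borel_measurable (noise \<epsilon> {0, 1, 2 :: nat})"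
      "(\<lambda>z. z 1) \<in> borel_measurable (noise \<epsilon> {0, 1, 2 :: nat})"
      "(\<lambda>z. z 2) \<in> borel_measurable (noise \<epsilon> {0, 1, 2 :: nat})"
      by (simp_all add: noise_component_measurable)
    show ?thesis
      unfolding vb_outcome_def Let_def clip_def by measurable
  qed
  have "(n * (vb_outcome xs z - data_var xs))\<^sup>2 \<le> (\<Sum>i\<in>{0, 1, 2}. c i * z i)\<^sup>2
      + (336 + 1120 * (\<Sum>i\<in>{0, 1, 2}. \<bar>z i\<bar>) ^ 4) / n" for z
  proof -
    define N where "N = z 0 + z 1 + z 2"
    have est: "vb_outcome xs z = clip ((n * a + z 2) / (n + N)
        - (n * r + (z 1 / 2 + z 2)) / (n + N) * ((n * r + (z 1 / 2 + z 2)) / (n + N))) 0 (1 / 4)"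
      unfolding vb_outcome_def Let_def s0 s1 sums N_def
      by (simp add: power2_eq_square add_divide_distrib diff_divide_distrib algebra_simps)
    have lin: "(\<Sum>i\<in>{0, 1, 2}. c i * z i)
        = (z 2 - a * N) - r * ((z 1 / 2 + z 2) - r * N) - r * ((z 1 / 2 + z 2) - r * N)"
      by (simp add: c_def w_def v N_def power2_eq_square algebra_simps)
    show ?thesis
      unfolding est lin v
      by (rule clipped_ratio_error) (use bounds in \<open>auto simp: N_def\<close>)
  qed
  from scaled_mse_le[OF assms(1) _ meas _ this[unfolded n_def]]
  have "risk (vb_hat \<epsilon>) data_var xs \<le> 2 / \<epsilon>\<^sup>2 * ((\<Sum>i\<in>{0, 1, 2}. (c i)\<^sup>2)
      + remainder \<epsilon> {0, 1, 2 :: nat} (length xs))"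
    using xs(1) by (simp add: risk_def vb_hat_def Suc_le_eq)
  also have "(\<Sum>i\<in>{0, 1, 2}. (c i)\<^sup>2) = C_b (mean xs) (centered_var xs)"
    by (simp add: c_def w_def C_b_def r_def centered_var_eq_data_var power2_eq_square
        eval_nat_numeral algebra_simps)
  finally show ?thesis .
qed

text \<open>As before the four cell weights add up to 1. The noise of cell \<open>(1, 0)\<close>
  enters \<open>S\<close> alone and that of \<open>(0, 1)\<close> enters \<open>T\<close> alone, so
  each has the direct contribution \<open>- r\<close>.\<close>

lemma risk_vc_le:
  assumes "\<epsilon> > 0" and xs: "xs \<noteq> []" "set xs \<subseteq> {0..1}"
  shows "risk (vc_hat \<epsilon>) data_var xs
    \<le> 2 / \<epsilon>\<^sup>2 * (C_c (mean xs) (centered_var xs)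
      + remainder \<epsilon> ({0 :: nat, 1} \<times> {0 :: nat, 1}) (length xs))"
proof -
  define n where "n = real (length xs)"
  define r where "r = mean xs"
  define a where "a = mean_sq xs"
  define w where "w = r\<^sup>2 - data_var xs"
  define c :: "nat \<times> nat \<Rightarrow> real"
    where "c i = (if i = (0, 0) then w else if i = (1, 1) then w + 1 - 2 * r else w - r)" for i
  have I: "{0, 1} \<times> {0, 1} = {(0, 0), (0, 1), (1, 0), (1, 1) :: nat \<times> nat}"
    by auto
  have sums: "sum_list xs = n * r" "(\<Sum>x\<leftarrow>xs. x\<^sup>2) = n * a"
    using sums_eq_means[OF xs(1)] by (simp_all add: n_def r_def a_def)
  have "(\<Sum>(x, y)\<leftarrow>zip xs xs. x * y) = (\<Sum>x\<leftarrow>xs. x\<^sup>2)"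
    "(\<Sum>(x, y)\<leftarrow>zip xs xs. x * (1 - y)) = sum_list xs - (\<Sum>x\<leftarrow>xs. x\<^sup>2)"
    "(\<Sum>(x, y)\<leftarrow>zip xs xs. (1 - x) * y) = sum_list xs - (\<Sum>x\<leftarrow>xs. x\<^sup>2)"
    "(\<Sum>(x, y)\<leftarrow>zip xs xs. (1 - x) * (1 - y)) = n - 2 * sum_list xs + (\<Sum>x\<leftarrow>xs. x\<^sup>2)"
    unfolding n_def by (induction xs) (simp_all add: power2_eq_square algebra_simps)
  note s = this[unfolded sums]
  have v: "data_var xs = a - r\<^sup>2"
    by (simp add: a_def r_def data_var_eq)
  have bounds: "1 \<le> n" "0 \<le> a" "a \<le> 1" "0 \<le> r" "r \<le> 1" "0 \<le> a - r\<^sup>2" "a - r\<^sup>2 \<le> 1 / 4"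
    using unit_interval_moments[OF xs] xs(1)
    unfolding data_var_eq a_def r_def n_def by (auto simp: Suc_le_eq)
  have meas: "c_outcome (zip xs xs) \<in> borel_measurable (noise \<epsilon> ({0, 1} \<times> {0, 1}))"
  proof -
    have [measurable]: "(\<lambda>z. z (0, 0)) \<in> borel_measurable (noise \<epsilon> ({0 :: nat, 1} \<times> {0 :: nat, 1}))"
      "(\<lambda>z. z (0, 1)) \<in> borel_measurable (noise \<epsilon> ({0 :: nat, 1} \<times> {0 :: nat, 1}))"
      "(\<lambda>z. z (1, 0)) \<in> borel_measurable (noise \<epsilon> ({0 :: nat, 1} \<times> {0 :: nat, 1}))"
      "(\<lambda>z. z (1, 1)) \<in> borel_measurable (noise \<epsilon> ({0 :: nat, 1} \<times> {0 :: nat, 1}))"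
      by (simp_all add: noise_component_measurable)
    show ?thesis
      unfolding c_outcome_def Let_def clip_def by measurable
  qed
  have "(n * (c_outcome (zip xs xs) z - data_var xs))\<^sup>2 \<le> (\<Sum>i\<in>{0, 1} \<times> {0, 1}. c i * z i)\<^sup>2
      + (336 + 1120 * (\<Sum>i\<in>{0, 1} \<times> {0, 1}. \<bar>z i\<bar>) ^ 4) / n" for z
  proof -
    define N where "N = z (0, 0) + z (0, 1) + z (1, 0) + z (1, 1)"
    have est: "c_outcome (zip xs xs) z = clip ((n * a + z (1, 1)) / (n + N)
        - (n * r + (z (1, 0) + z (1, 1))) / (n + N) * ((n * r + (z (0, 1) + z (1, 1))) / (n + N)))
        (- 1 / 4) (1 / 4)"
      unfolding c_outcome_def Let_def s N_def by (simp add: algebra_simps)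
    have lin: "(\<Sum>i\<in>{0, 1} \<times> {0, 1}. c i * z i) = (z (1, 1) - a * N)
        - r * ((z (1, 0) + z (1, 1)) - r * N) - r * ((z (0, 1) + z (1, 1)) - r * N)"
      by (simp add: I c_def w_def v N_def power2_eq_square algebra_simps)
    show ?thesis
      unfolding est lin v
      by (rule clipped_ratio_error) (use bounds in \<open>auto simp: I N_def\<close>)
  qed
  from scaled_mse_le[OF assms(1) _ meas _ this[unfolded n_def]]
  have "risk (vc_hat \<epsilon>) data_var xs \<le> 2 / \<epsilon>\<^sup>2 * ((\<Sum>i\<in>{0, 1} \<times> {0, 1}. (c i)\<^sup>2)
      + remainder \<epsilon> ({0 :: nat, 1} \<times> {0 :: nat, 1}) (length xs))"
    using xs(1) by (simp add: risk_def vc_hat_def c_hat_def Suc_le_eq)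
  also have "(\<Sum>i\<in>{0, 1} \<times> {0, 1}. (c i)\<^sup>2) = C_c (mean xs) (centered_var xs)"
    by (simp add: I c_def w_def C_c_def r_def centered_var_eq_data_var power2_eq_square
        eval_nat_numeral algebra_simps)
  finally show ?thesis .
qed

text \<open>The true bins are \<open>n - n * v\<close> and \<open>n * v\<close>, so the output is
  one clipped noisy ratio with target \<open>a = v\<close>, \<open>A = z 1\<close> and
  \<open>N = z 0 + z 1\<close>; no product of ratios occurs.\<close>

lemma risk_vu_le:
  assumes "\<epsilon> > 0" and xs: "xs \<noteq> []" "set xs \<subseteq> {0..1}"
  shows "risk (vu_hat \<epsilon>) data_var xs
    \<le> 2 / \<epsilon>\<^sup>2 * (C_u (mean xs) (centered_var xs) + remainder \<epsilon> {0, 1 :: nat} (length xs))"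
proof -
  define n where "n = real (length xs)"
  define v where "v = data_var xs"
  define c :: "nat \<Rightarrow> real" where "c i = (if i = 0 then - v else 1 - v)" for i
  have u: "(\<Sum>x\<leftarrow>xs. x\<^sup>2) - 1 / real (length xs) * (sum_list xs)\<^sup>2 = n * v"
    using xs(1) by (simp add: n_def v_def data_var_def power2_eq_square field_simps)
  have meas: "vu_outcome xs \<in> borel_measurable (noise \<epsilon> {0, 1})"
  proof -
    have [measurable]: "(\<lambda>z. z 0) \<in> borel_measurable (noise \<epsilon> {0, 1 :: nat})"
      "(\<lambda>z. z 1) \<in> borel_measurable (noise \<epsilon> {0, 1 :: nat})"
      by (simp_all add: noise_component_measurable)
    show ?thesis
      unfolding vu_outcome_def Let_def clip_def by measurable
  qed
  have "(n * (vu_outcome xs z - data_var xs))\<^sup>2 \<le> (\<Sum>i\<in>{0, 1}. c i * z i)\<^sup>2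
      + (336 + 1120 * (\<Sum>i\<in>{0, 1}. \<bar>z i\<bar>) ^ 4) / n" for z
  proof -
    have "vu_outcome xs z = clip ((n * v + z 1) / (n + (z 0 + z 1))) 0 (1 / 4)"
      unfolding vu_outcome_def Let_def u by (simp add: n_def algebra_simps)
    moreover have "(\<Sum>i\<in>{0, 1}. c i * z i) = z 1 - v * (z 0 + z 1)"
      by (simp add: c_def algebra_simps)
    ultimately show ?thesis
      using clipped_ratio_error[of n v 0 "z 1" "\<bar>z 0\<bar> + \<bar>z 1\<bar>" 0 0 "z 0 + z 1" 0 "1 / 4"]
        unit_interval_moments[OF xs] xs(1)
      by (simp add: n_def v_def Suc_le_eq abs_triangle_ineq)
  qed
  from scaled_mse_le[OF assms(1) _ meas _ this[unfolded n_def]]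
  have "risk (vu_hat \<epsilon>) data_var xs \<le> 2 / \<epsilon>\<^sup>2 * ((\<Sum>i\<in>{0, 1}. (c i)\<^sup>2)
      + remainder \<epsilon> {0, 1 :: nat} (length xs))"
    using xs(1) by (simp add: risk_def vu_hat_def Suc_le_eq)
  also have "(\<Sum>i\<in>{0, 1}. (c i)\<^sup>2) = C_u (mean xs) (centered_var xs)"
    by (simp add: c_def v_def C_u_def centered_var_eq_data_var)
  finally show ?thesis .
qed

section \<open>Comparison of the three constants\<close>

text \<open>The sums of squared coefficients differ by the second copy of
  \<open>(w - r)\<^sup>2\<close>, the price of splitting the middle bin into two noisy
  cells.\<close>

lemma C_b_le_C_c: "C_b r v \<le> C_c r v"
proof -
  have "C_c r v = C_b r v + (r\<^sup>2 - r - v)\<^sup>2"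
    by (simp add: C_b_def C_c_def power2_eq_square eval_nat_numeral algebra_simps)
  then show ?thesis by simp
qed

text \<open>Both constants depend on \<open>r\<close> only through \<open>p = r * (1 - r)\<close>,
  and their difference is \<open>4 * p - 4 * p\<^sup>2 - 8 * p * v - 2 * v\<^sup>2\<close>. It
  decreases in \<open>v\<close>, so the worst case is \<open>v = p\<close>, with value
  \<open>2 * p * (2 - 7 * p)\<close>; this is nonnegative as \<open>p \<le> 1 / 4\<close>.\<close>

lemma C_c_le_C_u:
  assumes "0 \<le> v" "v \<le> r * (1 - r)"
  shows "C_c r v \<le> C_u r v"
proof -
  define p where "p = r * (1 - r)"
  have p: "0 \<le> v" "v \<le> p" using assms by (auto simp: p_def)
  have "0 \<le> (r - 1 / 2)\<^sup>2" by simp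
  then have "p \<le> 1 / 4" by (simp add: p_def power2_eq_square algebra_simps)
  then have "0 \<le> 2 * p * (2 - 7 * p)" using p by (intro mult_nonneg_nonneg) auto
  also have "\<dots> \<le> 2 * p * (2 - 7 * p) + (p - v) * (10 * p + 2 * v)"
    using p by simp
  also have "\<dots> = C_u r v - C_c r v"
    by (simp add: p_def C_u_def C_c_def power2_eq_square algebra_simps)
  finally show ?thesis by simp
qed

section \<open>Assembly of the risk bounds and the comparison\<close>

theorem theorem5:
  fixes \<epsilon> :: real
  assumes "\<epsilon> > 0"
  shows
    "(\<exists>g :: nat \<Rightarrow> real. g \<longlonglongrightarrow> 0 \<and>
        (\<forall>xs. xs \<noteq> [] \<and> set xs \<subseteq> {0..1} \<longrightarrow>
          risk (vb_hat \<epsilon>) data_var xs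
            \<le> 2 / \<epsilon>\<^sup>2 * (C_b (mean xs) (centered_var xs) + g (length xs)))) \<and>
     (\<exists>g :: nat \<Rightarrow> real. g \<longlonglongrightarrow> 0 \<and>
        (\<forall>xs. xs \<noteq> [] \<and> set xs \<subseteq> {0..1} \<longrightarrow>
          risk (vc_hat \<epsilon>) data_var xs
            \<le> 2 / \<epsilon>\<^sup>2 * (C_c (mean xs) (centered_var xs) + g (length xs)))) \<and>
     (\<exists>g :: nat \<Rightarrow> real. g \<longlonglongrightarrow> 0 \<and>
        (\<forall>xs. xs \<noteq> [] \<and> set xs \<subseteq> {0..1} \<longrightarrow>
          risk (vu_hat \<epsilon>) data_var xs
            \<le> 2 / \<epsilon>\<^sup>2 * (C_u (mean xs) (centered_var xs) + g (length xs)))) \<and>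
     (\<forall>r v. (\<exists>xs. xs \<noteq> [] \<and> set xs \<subseteq> {0..1} \<and> r = mean xs \<and> v = centered_var xs) \<longrightarrow>
        C_b r v \<le> C_c r v \<and> C_c r v \<le> C_u r v)"
proof (intro conjI allI impI)
  show "\<exists>g :: nat \<Rightarrow> real. g \<longlonglongrightarrow> 0 \<and>
      (\<forall>xs. xs \<noteq> [] \<and> set xs \<subseteq> {0..1} \<longrightarrow>
        risk (vb_hat \<epsilon>) data_var xs
          \<le> 2 / \<epsilon>\<^sup>2 * (C_b (mean xs) (centered_var xs) + g (length xs)))"
    \<comment> \<open>The witness is \<open>remainder\<close> for the index set of the noise, which
      makes the convergence uniform over all datasets of a given size.\<close>
    using remainder_tendsto_0 risk_vb_le[OF assms] by blast
  show "\<exists>g :: nat \<Rightarrow> real. g \<longlonglongrightarrow> 0 \<and>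
      (\<forall>xs. xs \<noteq> [] \<and> set xs \<subseteq> {0..1} \<longrightarrow>
        risk (vc_hat \<epsilon>) data_var xs
          \<le> 2 / \<epsilon>\<^sup>2 * (C_c (mean xs) (centered_var xs) + g (length xs)))"
    using remainder_tendsto_0 risk_vc_le[OF assms] by blast
  show "\<exists>g :: nat \<Rightarrow> real. g \<longlonglongrightarrow> 0 \<and>
      (\<forall>xs. xs \<noteq> [] \<and> set xs \<subseteq> {0..1} \<longrightarrow>
        risk (vu_hat \<epsilon>) data_var xs
          \<le> 2 / \<epsilon>\<^sup>2 * (C_u (mean xs) (centered_var xs) + g (length xs)))"
    using remainder_tendsto_0 risk_vu_le[OF assms] by blast
next
  fix r v
  assume "\<exists>xs. xs \<noteq> [] \<and> set xs \<subseteq> {0..1} \<and> r = mean xs \<and> v = centered_var xs"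
  then have "0 \<le> v" "v \<le> r * (1 - r)"
    using unit_interval_moments by (auto simp: centered_var_eq_data_var)
  then show "C_c r v \<le> C_u r v"
    by (rule C_c_le_C_u)
qed (rule C_b_le_C_c)

end
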